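(* Let $f\in\mathcal{S}^*_{car}$ with $f(z)=z+\sum_{n=2}^{\infty}a_nz^n$. Then the third-order Hermitian--Toeplitz determinant $T_{3,1}(f)$ satisfies $$-\frac{841}{2295}\le T_{3,1}(f)\le 1.$$ Both inequalities are sharp, i.e. for each of the two inequalities there exists a function $f\in\mathcal{S}^*_{car}$ for which equality holds.
   Context: Let $\mathbb{D}=\{z\in\mathbb{C}:|z|<1\}$, and let $\mathcal{A}$ be the class of analytic functions $f$ on $\mathbb{D}$ with $f(0)=0$, $f'(0)=1$, so $f(z)=z+\sum_{n\ge2}a_nz^n$ (with $a_1=1$). For analytic functions $h,g$ on $\mathbb{D}$, $h\prec g$ ($h$ is subordinate to $g$) means that there is an analytic function $w$ on $\mathbb{D}$ with $w(0)=0$ and $|w(z)|\le|z|$ such that $h(z)=g(w(z))$ for all $z\in\mathbb{D}$. The class of starlike functions related to a cardioid is $$\mathcal{S}^*_{car}=\left\{f\in\mathcal{A}:\ \frac{zf'(z)}{f(z)}\prec 1+\tfrac43 z+\tfrac23 z^2\right\}.$$ The third-order Hermitian--Toeplitz determinant of $f$ is $$T_{3,1}(f)=\begin{vmatrix}1&a_2&a_3\\ \overline{a_2}&1&a_2\\ \overline{a_3}&\overline{a_2}&1\end{vmatrix}=2\operatorname{Re}\left(a_2^2\,\overline{a_3}\right)-2|a_2|^2-|a_3|^2+1.$$ *)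

theory Defs
  imports "HOL-Complex_Analysis.Complex_Analysis"
begin

abbreviation unit_disc :: "complex set" ("\<D>")
  where "\<D> \<equiv> ball 0 1"

definition class_A :: "(complex \<Rightarrow> complex) set" where
  "class_A = {f. f holomorphic_on \<D> \<and> f 0 = 0 \<and> deriv f 0 = 1}"

definition subordinate :: "(complex \<Rightarrow> complex) \<Rightarrow> (complex \<Rightarrow> complex) \<Rightarrow> bool" (infix "\<prec>s" 50)
  where
  "h \<prec>s g \<longleftrightarrow>
     h holomorphic_on \<D> \<and> g holomorphic_on \<D> \<and>
     (\<exists>w. w holomorphic_on \<D> \<and> w 0 = 0 \<and> (\<forall>z\<in>\<D>. norm (w z) \<le> norm z) \<and>
          (\<forall>z\<in>\<D>. h z = g (w z)))"

text \<open>
  The quotient \<open>z f'(z) / f(z)\<close> of a function \<open>f\<close> in \<open>class_A\<close> has a removable singularity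
  at \<open>0\<close>, with limit \<open>1\<close>.
\<close>
definition log_deriv_quot :: "(complex \<Rightarrow> complex) \<Rightarrow> complex \<Rightarrow> complex" where
  "log_deriv_quot f z = (if z = 0 then 1 else z * deriv f z / f z)"

text \<open>
  The condition \<open>f z \<noteq> 0\<close> is implicit in the subordination being about an analytic quotient;
  it is explicit here because division by \<open>0\<close> is total in HOL.
\<close>
definition starlike_car :: "(complex \<Rightarrow> complex) set" where
  "starlike_car = {f \<in> class_A. (\<forall>z \<in> \<D> - {0}. f z \<noteq> 0) \<and>
     log_deriv_quot f \<prec>s (\<lambda>z. 1 + 4/3 * z + 2/3 * z\<^sup>2)}"

definition taylor_coeff :: "(complex \<Rightarrow> complex) \<Rightarrow> nat \<Rightarrow> complex" where
  "taylor_coeff f n = fps_nth (fps_expansion f 0) n"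

definition hermitian_toeplitz_matrix3 :: "(complex \<Rightarrow> complex) \<Rightarrow> complex^3^3" where
  "hermitian_toeplitz_matrix3 f =
     (let a2 = taylor_coeff f 2; a3 = taylor_coeff f 3 in
      vector [vector [1, a2, a3],
              vector [cnj a2, 1, a2],
              vector [cnj a3, cnj a2, 1]])"

text \<open>
  The determinant of this Hermitian matrix is real, see \<open>of_real_hermitian_toeplitz31\<close>,
  so taking the real part only changes the type.
\<close>
definition hermitian_toeplitz31 :: "(complex \<Rightarrow> complex) \<Rightarrow> real" where
  "hermitian_toeplitz31 f = Re (det (hermitian_toeplitz_matrix3 f))"

lemma of_real_hermitian_toeplitz31:
  "complex_of_real (hermitian_toeplitz31 f) = det (hermitian_toeplitz_matrix3 f)"
  by (simp add: hermitian_toeplitz31_def hermitian_toeplitz_matrix3_def det_3 Let_def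
      complex_eq_iff algebra_simps)

lemma hermitian_toeplitz31_eq:
  fixes f defines "a \<equiv> taylor_coeff f"
  shows "hermitian_toeplitz31 f =
    2 * Re ((a 2)\<^sup>2 * cnj (a 3)) - 2 * (norm (a 2))\<^sup>2 - (norm (a 3))\<^sup>2 + 1"
  unfolding a_def cmod_power2
  by (simp add: hermitian_toeplitz31_def hermitian_toeplitz_matrix3_def det_3 Let_def
      power2_eq_square algebra_simps)

lemma class_A_taylor:
  assumes "f \<in> class_A"
  shows "taylor_coeff f 0 = 0" "taylor_coeff f 1 = 1"
    and "z \<in> \<D> \<Longrightarrow> (\<lambda>n. taylor_coeff f n * z ^ n) sums f z"
  using assms holomorphic_power_series[of f 0 1 z]
  by (auto simp: class_A_def taylor_coeff_def fps_expansion_def)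

end

theory Submission
  imports Defs
begin

text \<open>
  Write the subordinating function as \<open>w z = z * \<psi> z\<close> with \<open>\<bar>\<psi>\<bar> \<le> 1\<close>, and put \<open>p = \<psi> 0\<close>, \<open>q = \<psi>' 0\<close>.
  Comparing coefficients in \<open>z f' = f (1 + 4/3 w + 2/3 w\<^sup>2)\<close> gives \<open>a\<^sub>2 = 4/3 p\<close> and
  \<open>a\<^sub>3 = 2/3 q + 11/9 p\<^sup>2\<close>, so the determinant equals
  \<open>1 - 32/9 x + 77/27 x\<^sup>2 + 20/27 Re (p\<^sup>2 cnj q) - 4/9 \<bar>q\<bar>\<^sup>2\<close> with \<open>x = \<bar>p\<bar>\<^sup>2\<close>.
  The Schwarz--Pick inequality \<open>\<bar>q\<bar> \<le> 1 - x\<close> reduces both bounds to quadratics in \<open>x\<close>. The lower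
  one is \<open>(85 x\<^sup>2 - 92 x + 15) / 27\<close>, minimal at \<open>x = 46/85\<close> and attained when
  \<open>\<psi>\<close> is the disc automorphism \<open>(c - z) / (1 - c z)\<close> with \<open>c\<^sup>2 = 46/85\<close>.
\<close>

text \<open>The numerator of the quotient rule collapses to \<open>1 - (norm w)\<^sup>2\<close>. The
  formula serves at the point \<open>w\<close> for Schwarz-Pick and at 0 for the extremal
  function.\<close>

lemma Moebius_function_has_field_derivative:
  assumes "norm w < 1" "norm z \<le> 1"
  shows "(Moebius_function 0 w has_field_derivative
            of_real (1 - (norm w)\<^sup>2) / (1 - cnj w * z)\<^sup>2) (at z)"
proof -
  have "norm (cnj w * z) < 1"
    using assms by (simp add: norm_mult) (metis mult_left_le norm_ge_zero order_le_less_trans)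
  then have nz: "1 - cnj w * z \<noteq> 0"
    by auto
  have "((\<lambda>z. (z - w) / (1 - cnj w * z)) has_field_derivative
            (1 * (1 - cnj w * z) - (z - w) * (- cnj w)) / ((1 - cnj w * z) * (1 - cnj w * z))) (at z)"
    by (rule derivative_eq_intros refl nz | simp)+
  moreover have "1 * (1 - cnj w * z) - (z - w) * (- cnj w) = of_real (1 - (norm w)\<^sup>2)"
    by (simp add: complex_norm_square algebra_simps flip: of_real_power)
  moreover have "Moebius_function 0 w = (\<lambda>z. (z - w) / (1 - cnj w * z))"
    by (simp add: fun_eq_iff Moebius_function_simple)
  ultimately show ?thesis
    by (simp only: power2_eq_square)
qed

text \<open>A disc automorphism moving \<open>h 0\<close> to 0 turns this into the Schwarz lemma. It
  requires \<open>h\<close> to map into the open disc, so a value of modulus 1 is treated first: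
  there \<open>h\<close> is constant and the claim reads 0 \<le> 0.\<close>

lemma Schwarz_Pick_deriv_0:
  assumes holo: "h holomorphic_on ball 0 1"
    and le: "\<And>z. z \<in> ball 0 1 \<Longrightarrow> norm (h z) \<le> 1"
  shows "norm (deriv h 0) \<le> 1 - (norm (h 0))\<^sup>2"
proof (cases "\<exists>\<xi>\<in>ball 0 1. norm (h \<xi>) = 1")
  case True
  then obtain \<xi> where \<xi>: "\<xi> \<in> ball 0 1" "norm (h \<xi>) = 1" by blast
  have "h constant_on ball 0 1"
    by (rule maximum_modulus_principle[OF holo, of "ball 0 1" \<xi>]) (use \<xi> le in auto)
  then obtain c where c: "\<And>z. z \<in> ball 0 1 \<Longrightarrow> h z = c"
    by (auto simp: constant_on_def)
  have "eventually (\<lambda>z. h z = c) (nhds 0)"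
    using eventually_nhds_in_open[of "ball 0 1" "0::complex"] by (auto elim!: eventually_mono intro: c)
  then have "deriv h 0 = deriv (\<lambda>_. c) 0"
    by (intro deriv_cong_ev) auto
  moreover have "norm (h 0) = 1"
    using c[of 0] c[of \<xi>] \<xi> by simp
  ultimately show ?thesis
    by simp
next
  case False
  with le have less: "norm (h z) < 1" if "norm z < 1" for z
    using that by (force simp: order_less_le)
  define p where "p = h 0"
  have p: "norm p < 1"
    using less[of 0] by (simp add: p_def)
  define g where "g = Moebius_function 0 p \<circ> h"
  have "g holomorphic_on ball 0 1"
    unfolding g_def
    by (rule holomorphic_on_compose_gen[OF holo Moebius_function_holomorphic[OF p]])
       (use less in auto)
  moreover have "g 0 = 0"
    by (simp add: g_def p_def Moebius_function_eq_zero)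
  moreover have "norm (g z) < 1" if "norm z < 1" for z
    using Moebius_function_norm_lt_1[OF p less[OF that]] by (simp add: g_def)
  ultimately have "norm (deriv g 0) \<le> 1"
    by (rule Schwarz_Lemma(2)[where \<xi> = 0]) auto
  have sq: "(norm p)\<^sup>2 < 1"
    using p by (simp add: power_less_one_iff)
  have "(h has_field_derivative deriv h 0) (at 0)"
    by (rule holomorphic_derivI[OF holo]) auto
  then have "(g has_field_derivative
      of_real (1 - (norm p)\<^sup>2) / (1 - cnj p * h 0)\<^sup>2 * deriv h 0) (at 0)"
    unfolding g_def using Moebius_function_has_field_derivative[OF p, of "h 0"] p
    by (intro DERIV_chain) (auto simp: p_def)
  \<comment> \<open>At \<open>h 0 = p\<close> the squared denominator therefore cancels against the
    numerator up to one factor.\<close>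
  moreover have "1 - cnj p * h 0 = of_real (1 - (norm p)\<^sup>2)"
    by (simp add: p_def complex_norm_square mult.commute flip: of_real_power)
  ultimately have "deriv g 0 = deriv h 0 / of_real (1 - (norm p)\<^sup>2)"
    using sq by (simp add: DERIV_imp_deriv power2_eq_square)
  then have "norm (deriv g 0) = norm (deriv h 0) / (1 - (norm p)\<^sup>2)"
    using sq by (simp add: norm_divide del: of_real_diff)
  with \<open>norm (deriv g 0) \<le> 1\<close> sq show ?thesis
    by (simp add: p_def field_simps)
qed

lemma taylor_coeff_starlike_equation:
  assumes f: "f \<in> class_A" and \<psi>: "\<psi> holomorphic_on \<D>"
    and eq: "\<And>z. z \<in> \<D> \<Longrightarrow> z * deriv f z = f z * (1 + 4/3 * (z * \<psi> z) + 2/3 * (z * \<psi> z)\<^sup>2)"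
  shows "taylor_coeff f 2 = 4/3 * \<psi> 0"
    and "taylor_coeff f 3 = 2/3 * deriv \<psi> 0 + 11/9 * (\<psi> 0)\<^sup>2"
proof -
  define F where "F = fps_expansion f 0"
  define P where "P = fps_expansion \<psi> 0"
  have F [fps_expansion_intros]: "f has_fps_expansion F"
    unfolding F_def using f
    by (intro has_fps_expansion_fps_expansion[of "\<D>"]) (auto simp: class_A_def)
  have P [fps_expansion_intros]: "\<psi> has_fps_expansion P"
    unfolding P_def using \<psi> by (intro has_fps_expansion_fps_expansion[of "\<D>"]) auto
  define Q where "Q = 1 + fps_const (4/3) * (fps_X * P) + fps_const (2/3) * (fps_X * P)\<^sup>2"
  have lhs: "(\<lambda>z. z * deriv f z) has_fps_expansion fps_X * fps_deriv F"
    by (intro fps_expansion_intros)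
  have rhs: "(\<lambda>z. f z * (1 + 4/3 * (z * \<psi> z) + 2/3 * (z * \<psi> z)\<^sup>2)) has_fps_expansion F * Q"
    unfolding Q_def by (intro fps_expansion_intros)
  have ev: "eventually (\<lambda>z. z * deriv f z =
      f z * (1 + 4/3 * (z * \<psi> z) + 2/3 * (z * \<psi> z)\<^sup>2)) (nhds 0)"
    by (rule eventually_mono[OF eventually_nhds_in_open[of "\<D>" 0] eq]) auto
  have FP: "fps_X * fps_deriv F = F * Q"
    using fps_expansion_unique_complex[OF lhs] rhs has_fps_expansion_cong[OF ev refl] by simp
  have F01: "fps_nth F 0 = 0" "fps_nth F (Suc 0) = 1"
    using class_A_taylor(1,2)[OF f] by (simp_all add: taylor_coeff_def F_def)
  have P01: "fps_nth P 0 = \<psi> 0" "fps_nth P (Suc 0) = deriv \<psi> 0"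
    by (simp_all add: P_def fps_expansion_def)
  have Q: "fps_nth Q 0 = 1" "fps_nth Q (Suc 0) = 4/3 * \<psi> 0"
    "fps_nth Q (Suc (Suc 0)) = 4/3 * deriv \<psi> 0 + 2/3 * (\<psi> 0)\<^sup>2"
    by (simp_all add: Q_def power2_eq_square fps_mult_nth P01)
  \<comment> \<open>As \<open>Q\<close> has constant term 1, the summand \<open>i = n\<close>
    removes one copy of the left side, which leaves \<open>n - 1\<close> times the coefficient in
    terms of earlier ones.\<close>
  have coeff: "of_nat n * fps_nth F n = (\<Sum>i=0..n. fps_nth F i * fps_nth Q (n - i))" if "n > 0" for n
    using arg_cong[OF FP, of "\<lambda>A. fps_nth A n"] that by (simp add: fps_mult_nth[of F Q])
  have F2: "fps_nth F 2 = 4/3 * \<psi> 0"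
    using coeff[of 2] by (simp add: numeral_2_eq_2 F01 Q)
  then show "taylor_coeff f 2 = 4/3 * \<psi> 0"
    by (simp add: taylor_coeff_def F_def)
  have "2 * fps_nth F 3 = 4/3 * deriv \<psi> 0 + 2/3 * (\<psi> 0)\<^sup>2 + fps_nth F 2 * (4/3 * \<psi> 0)"
    using coeff[of 3] by (simp add: numeral_3_eq_3 numeral_2_eq_2 F01 Q)
  then have "2 * fps_nth F 3 = 2 * (2/3 * deriv \<psi> 0 + 11/9 * (\<psi> 0)\<^sup>2)"
    unfolding F2 by algebra
  then have "fps_nth F 3 = 2/3 * deriv \<psi> 0 + 11/9 * (\<psi> 0)\<^sup>2"
    by (simp only: mult_cancel_left) simp
  then show "taylor_coeff f 3 = 2/3 * deriv \<psi> 0 + 11/9 * (\<psi> 0)\<^sup>2"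
    by (simp add: taylor_coeff_def F_def)
qed

text \<open>The last two Taylor terms of the determinant combine: the mixed term has factor 64/27 -
  44/27 = 20/27, and the fourth power of \<open>norm (\<psi> 0)\<close> has factor 352/81 - 121/81 =
  77/27.\<close>

lemma hermitian_toeplitz31_starlike_equation:
  assumes "f \<in> class_A" and "\<psi> holomorphic_on \<D>"
    and "\<And>z. z \<in> \<D> \<Longrightarrow> z * deriv f z = f z * (1 + 4/3 * (z * \<psi> z) + 2/3 * (z * \<psi> z)\<^sup>2)"
  shows "hermitian_toeplitz31 f =
    1 - 32/9 * (norm (\<psi> 0))\<^sup>2 + 77/27 * ((norm (\<psi> 0))\<^sup>2)\<^sup>2
      + 20/27 * Re ((\<psi> 0)\<^sup>2 * cnj (deriv \<psi> 0)) - 4/9 * (norm (deriv \<psi> 0))\<^sup>2"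
proof -
  have a2: "taylor_coeff f 2 = 4/3 * \<psi> 0"
    by (rule taylor_coeff_starlike_equation(1)[OF assms])
  have a3: "taylor_coeff f 3 = 2/3 * deriv \<psi> 0 + 11/9 * (\<psi> 0)\<^sup>2"
    by (rule taylor_coeff_starlike_equation(2)[OF assms])
  show ?thesis
    unfolding hermitian_toeplitz31_eq a2 a3 cmod_power2
    by (simp add: power2_eq_square field_simps)
qed

text \<open>The zero of the subordinating function at 0 is divided out. The equation is stated as a
  product so that it also holds at 0 and can be compared as power series.\<close>

lemma starlike_car_imp_equation:
  assumes "f \<in> starlike_car"
  obtains \<psi> where "\<psi> holomorphic_on \<D>" "\<And>z. z \<in> \<D> \<Longrightarrow> norm (\<psi> z) \<le> 1"
    "\<And>z. z \<in> \<D> \<Longrightarrow> z * deriv f z = f z * (1 + 4/3 * (z * \<psi> z) + 2/3 * (z * \<psi> z)\<^sup>2)"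
proof -
  have f0: "f 0 = 0" and nz: "\<And>z. z \<in> \<D> \<Longrightarrow> z \<noteq> 0 \<Longrightarrow> f z \<noteq> 0"
    using assms by (auto simp: starlike_car_def class_A_def)
  obtain w where w: "w holomorphic_on \<D>" "w 0 = 0" "\<And>z. z \<in> \<D> \<Longrightarrow> norm (w z) \<le> norm z"
    and eq: "\<And>z. z \<in> \<D> \<Longrightarrow> log_deriv_quot f z = 1 + 4/3 * w z + 2/3 * (w z)\<^sup>2"
    using assms unfolding starlike_car_def subordinate_def by auto
  obtain \<psi> where \<psi>: "\<psi> holomorphic_on \<D>" "\<And>z. norm z < 1 \<Longrightarrow> w z = z * \<psi> z" "deriv w 0 = \<psi> 0"
    using Schwarz3[OF w(1,2)] by blast
  show ?thesis
  proof
    show "norm (\<psi> z) \<le> 1" if z: "z \<in> \<D>" for z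
    \<comment> \<open>Division by \<open>z\<close> gives the bound away from 0; at 0 the value is
      \<open>deriv w 0\<close>, which the Schwarz lemma bounds.\<close>
    proof (cases "z = 0")
      case True
      have "norm (w z) < 1" if "norm z < 1" for z
        using w(3)[of z] that by simp
      from Schwarz_Lemma(2)[OF w(1,2) this, of 0] True \<psi>(3) show ?thesis
        by simp
    next
      case False
      with w(3)[OF z] \<psi>(2)[of z] z show ?thesis
        by (simp add: norm_mult)
    qed
    show "z * deriv f z = f z * (1 + 4/3 * (z * \<psi> z) + 2/3 * (z * \<psi> z)\<^sup>2)" if z: "z \<in> \<D>" for z
    proof (cases "z = 0")
      case False
      with eq[OF z] nz[OF z] \<psi>(2)[of z] z show ?thesis
        by (simp add: log_deriv_quot_def divide_eq_eq mult.commute)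
    qed (simp add: f0)
  qed (fact \<psi>(1))
qed

text \<open>The function is \<open>z * exp F\<close>, where \<open>F\<close> is the primitive of \<open>(z f' / f - 1) / z\<close> with \<open>F 0 = 0\<close>.\<close>

lemma exists_starlike_car_equation:
  assumes \<psi>: "\<psi> holomorphic_on \<D>" and le: "\<And>z. z \<in> \<D> \<Longrightarrow> norm (\<psi> z) \<le> 1"
  obtains f where "f \<in> starlike_car"
    "\<And>z. z \<in> \<D> \<Longrightarrow> z * deriv f z = f z * (1 + 4/3 * (z * \<psi> z) + 2/3 * (z * \<psi> z)\<^sup>2)"
proof -
  \<comment> \<open>The factor \<open>z\<close> is cancelled by hand, so \<open>k\<close> is visibly
    holomorphic at 0.\<close>
  define k where "k = (\<lambda>z. 4/3 * \<psi> z + 2/3 * z * (\<psi> z)\<^sup>2)"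
  have "k holomorphic_on \<D>"
    unfolding k_def by (intro holomorphic_intros \<psi>)
  then obtain G where G: "\<And>z. z \<in> \<D> \<Longrightarrow> (G has_field_derivative k z) (at z within \<D>)"
    using holomorphic_convex_primitive'[of \<D> k] by auto
  \<comment> \<open>With \<open>F 0 = 0\<close> the function \<open>z * exp (F z)\<close> has
    derivative 1 at 0.\<close>
  define F where "F = (\<lambda>z. G z - G 0)"
  have F: "(F has_field_derivative k z) (at z)" if "z \<in> \<D>" for z
    using G[OF that] that unfolding F_def
    by (auto simp: at_within_open[of _ \<D>] intro!: derivative_eq_intros)
  define f where "f = (\<lambda>z. z * exp (F z))"
  have f': "(f has_field_derivative exp (F z) * (1 + z * k z)) (at z)" if "z \<in> \<D>" for z
    unfolding f_def by (auto intro!: derivative_eq_intros F[OF that] simp: algebra_simps)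
  have deriv: "deriv f z = exp (F z) * (1 + z * k z)" if "z \<in> \<D>" for z
    by (rule DERIV_imp_deriv[OF f'[OF that]])
  have "f holomorphic_on \<D>"
    using f' holomorphic_on_open[of "\<D>" f] by blast
  then have A: "f \<in> class_A"
    by (simp add: class_A_def deriv) (simp add: f_def F_def)
  have zk: "1 + z * k z = 1 + 4/3 * (z * \<psi> z) + 2/3 * (z * \<psi> z)\<^sup>2" for z
    by (simp add: k_def power2_eq_square algebra_simps)
  have quot: "log_deriv_quot f z = 1 + 4/3 * (z * \<psi> z) + 2/3 * (z * \<psi> z)\<^sup>2" if "z \<in> \<D>" for z
    unfolding zk[symmetric] using deriv[OF that] by (simp add: log_deriv_quot_def f_def)
  have "(\<lambda>z. 1 + 4/3 * (z * \<psi> z) + 2/3 * (z * \<psi> z)\<^sup>2) holomorphic_on \<D>"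
    by (intro holomorphic_intros \<psi>)
  then have "log_deriv_quot f holomorphic_on \<D>"
    by (rule holomorphic_transform) (simp add: quot)
  moreover have "(\<lambda>z. z * \<psi> z) holomorphic_on \<D>"
    by (intro holomorphic_intros \<psi>)
  moreover have "norm (z * \<psi> z) \<le> norm z" if "z \<in> \<D>" for z
    using le[OF that] by (simp add: norm_mult mult_left_le)
  ultimately have "log_deriv_quot f \<prec>s (\<lambda>z. 1 + 4/3 * z + 2/3 * z\<^sup>2)"
    unfolding subordinate_def
    using quot by (intro conjI exI[of _ "\<lambda>z. z * \<psi> z"] ballI holomorphic_intros) (simp_all add: \<psi>)
  \<comment> \<open>Since \<open>exp\<close> has no zeros, \<open>f\<close> vanishes only at
    0.\<close>
  then have "f \<in> starlike_car"
    using A by (simp add: starlike_car_def f_def)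
  moreover have "z * deriv f z = f z * (1 + 4/3 * (z * \<psi> z) + 2/3 * (z * \<psi> z)\<^sup>2)" if "z \<in> \<D>" for z
    unfolding zk[symmetric] deriv[OF that] by (simp add: f_def)
  ultimately show ?thesis
    by (rule that)
qed

theorem theorem4p1:
  shows "(\<forall>f\<in>starlike_car. - (841/2295) \<le> hermitian_toeplitz31 f \<and> hermitian_toeplitz31 f \<le> 1) \<and>
         (\<exists>f\<in>starlike_car. hermitian_toeplitz31 f = - (841/2295)) \<and>
         (\<exists>f\<in>starlike_car. hermitian_toeplitz31 f = 1)"
proof (intro conjI ballI)
  fix f assume f: "f \<in> starlike_car"
  then have A: "f \<in> class_A"
    by (simp add: starlike_car_def)
  obtain \<psi> where \<psi>: "\<psi> holomorphic_on \<D>" "\<And>z. z \<in> \<D> \<Longrightarrow> norm (\<psi> z) \<le> 1"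
    "\<And>z. z \<in> \<D> \<Longrightarrow> z * deriv f z = f z * (1 + 4/3 * (z * \<psi> z) + 2/3 * (z * \<psi> z)\<^sup>2)"
    using starlike_car_imp_equation[OF f] by blast
  define x where "x = (norm (\<psi> 0))\<^sup>2"
  define y where "y = norm (deriv \<psi> 0)"
  define R where "R = Re ((\<psi> 0)\<^sup>2 * cnj (deriv \<psi> 0))"
  have T: "hermitian_toeplitz31 f = 1 - 32/9 * x + 77/27 * x\<^sup>2 + 20/27 * R - 4/9 * y\<^sup>2"
    using hermitian_toeplitz31_starlike_equation[OF A \<psi>(1,3)] by (simp add: x_def y_def R_def)
  have x: "0 \<le> x" and y: "0 \<le> y" "y \<le> 1 - x"
    using Schwarz_Pick_deriv_0[OF \<psi>(1,2)] by (simp_all add: x_def y_def)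
  have "\<bar>R\<bar> \<le> x * y"
    using abs_Re_le_cmod[of "(\<psi> 0)\<^sup>2 * cnj (deriv \<psi> 0)"]
    by (simp add: R_def x_def y_def norm_mult norm_power)
  moreover have "x * y \<le> x * (1 - x)"
    using x y by (intro mult_left_mono)
  ultimately have R: "\<bar>R\<bar> \<le> x * (1 - x)"
    by simp
  have y2: "y\<^sup>2 \<le> (1 - x)\<^sup>2"
    using y by (intro power_mono)
  \<comment> \<open>This is the completed square of the worst case \<open>R = - x * (1 - x)\<close>,
    \<open>y = 1 - x\<close>.\<close>
  have "0 \<le> 85/27 * (x - 46/85)\<^sup>2"
    by simp
  also have "\<dots> = 841/2295 + (1 - 32/9 * x + 77/27 * x\<^sup>2 - 20/27 * (x * (1 - x)) - 4/9 * (1 - x)\<^sup>2)"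
    by (simp add: power2_eq_square field_simps)
  finally show "- (841/2295) \<le> hermitian_toeplitz31 f"
    using R y2 unfolding T abs_le_iff by linarith
  \<comment> \<open>For the upper bound take \<open>R = x * (1 - x)\<close> and drop the
    \<open>y\<^sup>2\<close> term. The factorisation shows the sign, as \<open>x\<close> lies
    between 0 and 1.\<close>
  have "32/9 * x - 77/27 * x\<^sup>2 - 20/27 * (x * (1 - x)) = x * (19 + 57 * (1 - x)) / 27"
    by (simp add: power2_eq_square field_simps)
  moreover have "0 \<le> x * (19 + 57 * (1 - x)) / 27"
    using x y by simp
  moreover have "0 \<le> y\<^sup>2"
    by simp
  ultimately show "hermitian_toeplitz31 f \<le> 1"
    using R unfolding T abs_le_iff by linarith
next
  define c where "c = complex_of_real (sqrt (46/85))"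
  have c: "(norm c)\<^sup>2 = 46/85" "c\<^sup>2 = 46/85"
    by (simp_all add: c_def flip: of_real_power)
  have c1: "norm c < 1"
    by (rule power2_less_imp_less) (simp_all add: c)
  \<comment> \<open>The automorphism gives equality in Schwarz-Pick, and the minus sign makes
    \<open>\<psi> 0\<close> positive and \<open>deriv \<psi> 0\<close> negative, so \<open>R\<close>
    takes its least value \<open>- x * (1 - x)\<close>.\<close>
  define \<psi> where "\<psi> = (\<lambda>z. - Moebius_function 0 c z)"
  have \<psi>: "\<psi> holomorphic_on \<D>"
    unfolding \<psi>_def using Moebius_function_holomorphic[OF c1] by (intro holomorphic_intros)
  have "norm (\<psi> z) \<le> 1" if "z \<in> \<D>" for z
    using Moebius_function_norm_lt_1[OF c1, of z 0] that by (simp add: \<psi>_def)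
  then obtain f where f: "f \<in> starlike_car"
    "\<And>z. z \<in> \<D> \<Longrightarrow> z * deriv f z = f z * (1 + 4/3 * (z * \<psi> z) + 2/3 * (z * \<psi> z)\<^sup>2)"
    using exists_starlike_car_equation[OF \<psi>] by metis
  have A: "f \<in> class_A"
    using f by (simp add: starlike_car_def)
  have p: "\<psi> 0 = c"
    by (simp add: \<psi>_def Moebius_function_of_zero)
  have "(\<psi> has_field_derivative - (of_real (1 - (norm c)\<^sup>2) / (1 - cnj c * 0)\<^sup>2)) (at 0)"
    unfolding \<psi>_def by (intro DERIV_minus Moebius_function_has_field_derivative c1) simp
  then have q: "deriv \<psi> 0 = - (39/85)"
    using DERIV_imp_deriv by (fastforce simp: c)
  have "hermitian_toeplitz31 f = - (841/2295)"
    using hermitian_toeplitz31_starlike_equation[OF A \<psi> f(2)] unfolding p q c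
    by (simp add: power2_eq_square)
  with f(1) show "\<exists>f\<in>starlike_car. hermitian_toeplitz31 f = - (841/2295)"
    by blast
next
  \<comment> \<open>The choice \<psi> = 0 yields the identity on the disc, whose second and third
    coefficients vanish.\<close>
  obtain f where f: "f \<in> starlike_car"
    "\<And>z. z \<in> \<D> \<Longrightarrow> z * deriv f z = f z * (1 + 4/3 * (z * 0) + 2/3 * (z * 0)\<^sup>2)"
    using exists_starlike_car_equation[of "\<lambda>_. 0"] by auto
  have A: "f \<in> class_A"
    using f by (simp add: starlike_car_def)
  have "hermitian_toeplitz31 f = 1"
    using hermitian_toeplitz31_starlike_equation[OF A _ f(2)] by simp
  with f(1) show "\<exists>f\<in>starlike_car. hermitian_toeplitz31 f = 1"
    by blast
qed

end
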